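(* Let $n\ge2$ and let $A_1,\dots,A_m\in\mathbb{S}^n$ satisfy $\operatorname{tr}A_i=0$ and $\operatorname{tr}(A_iA_j)=\delta_{ij}$ for all $i,j=1,\dots,m$. Let $\mathbf{b}\in\mathbb{R}^m\setminus\mathscr{M}$, let $\delta:=\operatorname{dist}(\mathbf{b},\partial\mathscr{M})$, let $f(\mathbf{y})=\log\operatorname{tr}\exp A(\mathbf{y})-\mathbf{b}^T\mathbf{y}$, and let $(\mathbf{y}_k)_{k\ge0}$ be generated from $\mathbf{y}_0\in\mathbb{R}^m$ by the gradient method $\mathbf{y}_{k+1}=\mathbf{y}_k-2\nabla f(\mathbf{y}_k)$. Then $$f(\mathbf{y}_k)\le f(\mathbf{y}_0)-k\delta^2\qquad\text{for all }k\ge0.$$ Consequently, $f(\mathbf{y}_k)<0$ for every integer $k\geq 0$ with $k>f(\mathbf{y}_0)/\delta^2$. In particular, if $\mathbf{y}_0=0$, then $f(\mathbf{y}_k)<0$ for every integer $k>(\log n)/\delta^2$. At any iterate with $f(\mathbf{y}_k)<0$, the vector $\mathbf{v}:=\mathbf{y}_k$ separates $\mathbf{b}$ from $\mathscr{M}$: $\lambda_{\max}(A(\mathbf{v}))<\mathbf{b}^T\mathbf{v}$ (thus infeasibility is certified). Moreover, $f(\mathbf{y}_k)\to-\infty$ and $\|\mathbf{y}_k\|_2\to\infty$ as $k\to\infty$.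
   Context: $\mathbb{S}^n$ is the space of real symmetric $n\times n$ matrices, and $\mathbb{S}^n_1=\{X\in\mathbb{S}^n: X\succeq 0,\ \operatorname{tr}X=1\}$. $\delta_{ij}$ equals $1$ if $i=j$ and $0$ otherwise. $A(\mathbf{y})=\sum_{i=1}^m y_iA_i$, $\mathcal{A}(X)=(\operatorname{tr}(A_iX))_{i=1,\dots,m}$, and the moment body is $\mathscr{M}=\mathcal{A}(\mathbb{S}^n_1)\subset\mathbb{R}^m$, with boundary $\partial\mathscr{M}$ in $\mathbb{R}^m$; distances are Euclidean. The support function of $\mathscr{M}$ is $\max_{\mathbf{z}\in\mathscr{M}}\mathbf{v}^T\mathbf{z}=\lambda_{\max}(A(\mathbf{v}))$. The gradient of $f$ is $\nabla f(\mathbf{y})=\mathcal{A}(X(\mathbf{y}))-\mathbf{b}$ with $X(\mathbf{y})=\exp A(\mathbf{y})/\operatorname{tr}\exp A(\mathbf{y})$. *)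

theory Defs
  imports "HOL-Analysis.Analysis"
begin

definition sym_matrix :: "real^'n^'n \<Rightarrow> bool" where
  "sym_matrix X \<longleftrightarrow> transpose X = X"

definition psd_matrix :: "real^'n^'n \<Rightarrow> bool" where
  "psd_matrix X \<longleftrightarrow> sym_matrix X \<and> (\<forall>u. 0 \<le> u \<bullet> (X *v u))"

definition spectrahedron :: "(real^'n^'n) set" where
  "spectrahedron = {X. psd_matrix X \<and> trace X = 1}"

definition eigenvalues :: "real^'n^'n \<Rightarrow> real set" where
  "eigenvalues X = {c. \<exists>u. u \<noteq> 0 \<and> X *v u = c *\<^sub>R u}"

text \<open>Only used for symmetric matrices, where the set of real eigenvalues is finite and
  non-empty.\<close>

definition lambda_max :: "real^'n^'n \<Rightarrow> real" where
  "lambda_max X = Max (eigenvalues X)"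

text \<open>The library multiplication on \<^typ>\<open>real^'n^'n\<close> is componentwise, so
  powers with respect to the matrix product \<open>**\<close> and the matrix exponential are introduced
  here.\<close>

primrec mat_power :: "real^'n^'n \<Rightarrow> nat \<Rightarrow> real^'n^'n" where
  "mat_power X 0 = mat 1"
| "mat_power X (Suc k) = X ** mat_power X k"

definition mat_exp :: "real^'n^'n \<Rightarrow> real^'n^'n" where
  "mat_exp X = (\<Sum>k. (1 / fact k) *\<^sub>R mat_power X k)"

definition pencil :: "('m \<Rightarrow> real^'n^'n) \<Rightarrow> real^'m \<Rightarrow> real^'n^'n" where
  "pencil A y = (\<Sum>i\<in>UNIV. y $ i *\<^sub>R A i)"

definition moment_map :: "('m \<Rightarrow> real^'n^'n) \<Rightarrow> real^'n^'n \<Rightarrow> real^'m" where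
  "moment_map A X = (\<chi> i. trace (A i ** X))"

definition moment_body :: "('m \<Rightarrow> real^'n^'n) \<Rightarrow> (real^'m) set" where
  "moment_body A = moment_map A ` spectrahedron"

definition objective :: "('m \<Rightarrow> real^'n^'n) \<Rightarrow> real^'m \<Rightarrow> real^'m \<Rightarrow> real" where
  "objective A b y = ln (trace (mat_exp (pencil A y))) - b \<bullet> y"

definition gradient :: "('a::real_inner \<Rightarrow> real) \<Rightarrow> 'a \<Rightarrow> 'a" where
  "gradient f x = (THE D. GDERIV f x :> D)"

lemma gradient_eq:
  assumes "GDERIV f x :> D"
  shows "gradient f x = D"
  unfolding gradient_def
proof (rule the_equality)
  show "GDERIV f x :> D" by (fact assms)
next
  fix D' assume "GDERIV f x :> D'"
  with assms have "(\<lambda>h. h \<bullet> D') = (\<lambda>h. h \<bullet> D)"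
    unfolding gderiv_def by (metis has_derivative_unique)
  then show "D' = D"
    by (metis inner_commute vector_eq_ldot)
qed

end

theory Submission
  imports Defs "HOL-Real_Asymp.Real_Asymp"
begin

text \<open>
  Write \<open>F X = ln (trace (exp X))\<close> on symmetric matrices and let \<open>G X = exp X / trace (exp X)\<close>
  be the Gibbs state. Everything rests on the two-sided estimate
  \<open>0 \<le> F (X + K) - F X - trace (G X ** K) \<le> |K|\<^sup>2 / 4\<close>
  in the Frobenius norm (\<open>log_partition_ge\<close> and \<open>log_partition_smooth\<close>). The pencil is an isometry
  because the \<open>A i\<close> are orthonormal, so the estimate transfers to the objective: it identifies
  the gradient as \<open>r = moment_map A (G (pencil A x)) - b\<close>, and says that a gradient step of
  length 2 changes the objective by at most
  \<open>- 2 * |r|\<^sup>2 + |2 * r|\<^sup>2 / 4 = - |r|\<^sup>2\<close>. Since \<open>r\<close> joins \<open>b\<close> to a point of the moment body and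
  the segment between them crosses the boundary, \<open>|r| \<ge> \<delta>\<close>, and each step gains \<open>\<delta>\<^sup>2\<close>.
  Every eigenvalue of \<open>X\<close> is at most \<open>F X\<close>, so a negative objective is a separation certificate.
  The objective lies above an affine function, so it can tend to minus infinity only if the
  iterates are unbounded in norm.

  The estimate is obtained without differentiating the matrix exponential. Take symmetric
  \<open>A\<close>, \<open>B\<close> with orthonormal eigenbases \<open>f\<close>, \<open>g\<close>, and give the pair \<open>(a, b)\<close> the weight
  \<open>(f a \<bullet> g b)\<^sup>2\<close>. Traces of \<open>G A\<close> or \<open>G B\<close> against \<open>B - A\<close> and its square become weighted sums in
  which \<open>B - A\<close> acts as the scalar difference of the eigenvalues (\<open>gibbs_coupling\<close>), so scalar
  inequalities for \<open>exp\<close> apply term by term. Convexity of \<open>exp\<close> gives the lower bound. For the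
  upper bound, the fact that the logarithmic mean is at most the arithmetic mean bounds
  \<open>d = trace ((G B - G A) ** (B - A))\<close> by the averaged variances of \<open>B - A\<close> in the two Gibbs
  states plus \<open>d\<^sup>2 / 2\<close> (\<open>gibbs_increment_le\<close>). A variance of \<open>K\<close> is at most \<open>|K|\<^sup>2 / 2\<close>
  (\<open>variance_spectrahedron_le\<close>), and the error \<open>d\<^sup>2 / 2\<close> disappears when the segment from \<open>A\<close>
  to \<open>B\<close> is cut into ever shorter pieces.
\<close>

section \<open>Spectral theorem\<close>

definition orthonormal_frame :: "('n \<Rightarrow> real^'n) \<Rightarrow> bool" where
  "orthonormal_frame f \<longleftrightarrow> (\<forall>a b. f a \<bullet> f b = (if a = b then 1 else 0))"

definition eigenframe :: "real^'n^'n \<Rightarrow> ('n \<Rightarrow> real^'n) \<Rightarrow> ('n \<Rightarrow> real) \<Rightarrow> bool" where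
  "eigenframe X f l \<longleftrightarrow> orthonormal_frame f \<and> (\<forall>a. X *v f a = l a *\<^sub>R f a)"

lemma orthonormal_frame_nonzero: "orthonormal_frame f \<Longrightarrow> f a \<noteq> 0"
  unfolding orthonormal_frame_def by (metis inner_zero_left zero_neq_one)

lemma sym_matrix_inner:
  "sym_matrix X \<Longrightarrow> x \<bullet> (X *v y) = (X *v x) \<bullet> y"
  unfolding sym_matrix_def
  by (metis dot_lmul_matrix transpose_matrix_vector)

text \<open>A maximizer \<open>u\<close> of the quadratic form on the unit sphere of the subspace is an eigenvector:
  otherwise moving from \<open>u\<close> in the direction of the residual \<open>w = X *v u - c *\<^sub>R u\<close>, which stays
  in the subspace, would raise the Rayleigh quotient above its maximum \<open>c\<close>.\<close>

lemma eigenvector_in_invariant_subspace: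
  fixes X :: "real^'n^'n"
  assumes sym: "sym_matrix X" and V: "subspace V"
    and inv: "\<And>x. x \<in> V \<Longrightarrow> X *v x \<in> V"
    and ne: "V \<noteq> {0}"
  obtains u c where "u \<in> V" "norm u = 1" "X *v u = c *\<^sub>R u"
proof -
  let ?S = "sphere 0 1 \<inter> V"
  have "compact ?S"
    by (intro compact_Int_closed compact_sphere closed_subspace V)
  moreover have "?S \<noteq> {}"
  proof -
    obtain x where "x \<in> V" "x \<noteq> 0" using ne subspace_0[OF V] by blast
    then have "x /\<^sub>R norm x \<in> ?S"
      using V by (simp add: subspace_scale)
    then show ?thesis by blast
  qed
  moreover have "continuous_on ?S (\<lambda>x. x \<bullet> (X *v x))"
    by (intro continuous_intros matrix_vector_mult_linear_continuous_on)
  ultimately obtain u where u: "u \<in> ?S" and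
    max: "\<And>x. x \<in> ?S \<Longrightarrow> x \<bullet> (X *v x) \<le> u \<bullet> (X *v u)"
    using continuous_attains_sup[of ?S "\<lambda>x. x \<bullet> (X *v x)"] by blast
  define c where "c = u \<bullet> (X *v u)"
  have uu: "u \<bullet> u = 1" and uV: "u \<in> V" using u by (auto simp: dot_square_norm)
  have form: "x \<bullet> (X *v x) \<le> c * (x \<bullet> x)" if "x \<in> V" for x
  proof (cases "x = 0")
    case False
    have "(x /\<^sub>R norm x) \<bullet> (X *v (x /\<^sub>R norm x)) \<le> c"
      unfolding c_def using that False V by (intro max) (simp add: subspace_scale)
    then have "(x \<bullet> (X *v x)) / (norm x * norm x) \<le> c"
      by (simp add: matrix_vector_mult_scaleR divide_simps)
    then show ?thesis
      using False by (simp add: divide_simps dot_square_norm power2_eq_square)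
  qed simp
  define w where "w = X *v u - c *\<^sub>R u"
  have wV: "w \<in> V"
    unfolding w_def using uV inv V by (simp add: subspace_diff subspace_scale)
  define p where "p = c * (w \<bullet> w) - w \<bullet> (X *v w)"
  have p0: "p \<ge> 0" unfolding p_def using form[OF wV] by simp
  have uXw: "u \<bullet> (X *v w) = w \<bullet> (X *v u)"
    using sym_matrix_inner[OF sym, of u w] by (simp add: inner_commute)
  have ww: "w \<bullet> (X *v u) = w \<bullet> w + c * (w \<bullet> u)"
    unfolding w_def by (simp add: inner_diff_right)
  \<comment> \<open>The form inequality at \<open>u + t *\<^sub>R w\<close>; the linear term in \<open>t\<close> forces \<open>w = 0\<close>.\<close>
  have quad: "0 \<le> t\<^sup>2 * p - 2 * t * (w \<bullet> w)" for t
  proof -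
    have "u + t *\<^sub>R w \<in> V" using uV wV V by (simp add: subspace_add subspace_scale)
    from form[OF this] show ?thesis
      unfolding p_def using uu
      by (simp add: matrix_vector_right_distrib matrix_vector_mult_scaleR inner_add_left
          inner_add_right uXw ww inner_commute[of w u] c_def[symmetric] power2_eq_square algebra_simps)
  qed
  have "w \<bullet> w = 0"
  proof (rule ccontr)
    assume "w \<bullet> w \<noteq> 0"
    then have pos: "w \<bullet> w > 0" by simp
    show False
    proof (cases "p = 0")
      case True
      then show False using quad[of 1] pos by simp
    next
      case False
      have "((w \<bullet> w) / p)\<^sup>2 * p - 2 * ((w \<bullet> w) / p) * (w \<bullet> w) = - ((w \<bullet> w)\<^sup>2 / p)"
        using False by (simp add: power2_eq_square field_simps)
      then have "(w \<bullet> w)\<^sup>2 / p \<le> 0" using quad[of "(w \<bullet> w) / p"] by simp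
      moreover have "(w \<bullet> w)\<^sup>2 / p > 0" using pos False p0 by simp
      ultimately show False by simp
    qed
  qed
  then have "X *v u = c *\<^sub>R u" unfolding w_def by simp
  then show thesis using that[of u c] u by simp
qed

text \<open>A largest orthonormal set of eigenvectors spans: its orthogonal complement is invariant, so
  if it were nonzero it would contain a further eigenvector.\<close>

theorem spectral_theorem:
  fixes X :: "real^'n^'n"
  assumes sym: "sym_matrix X"
  obtains f l where "eigenframe X f l"
proof -
  define P where "P B \<longleftrightarrow> pairwise orthogonal B \<and> (\<forall>v\<in>B. norm v = 1 \<and> (\<exists>c. X *v v = c *\<^sub>R v))"
    for B :: "(real^'n) set"
  have ind: "independent B" if "P B" for B
    using that unfolding P_def by (intro pairwise_orthogonal_independent) auto
  have bound: "finite B \<and> card B \<le> CARD('n)" if "P B" for B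
    using independent_bound[OF ind[OF that]] by simp
  have "P {}" by (simp add: P_def)
  then obtain B where PB: "P B" and max: "\<And>C. P C \<Longrightarrow> card C \<le> card B"
    using ex_has_greatest_nat[of P "{}" card "Suc CARD('n)"] bound
    by (auto simp: less_Suc_eq_le)
  have fin: "finite B" using bound[OF PB] by simp
  define V where "V = {x. \<forall>v\<in>B. v \<bullet> x = 0}"
  have subV: "subspace V"
    unfolding V_def subspace_def by (simp add: inner_add_right)
  have invV: "X *v x \<in> V" if "x \<in> V" for x
    unfolding V_def
  proof safe
    fix v assume v: "v \<in> B"
    then obtain c where "X *v v = c *\<^sub>R v" using PB unfolding P_def by blast
    then have "v \<bullet> (X *v x) = c * (v \<bullet> x)"
      by (simp add: sym_matrix_inner[OF sym])
    then show "v \<bullet> (X *v x) = 0" using that v by (simp add: V_def)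
  qed
  have V0: "V = {0}"
  proof (rule ccontr)
    assume "V \<noteq> {0}"
    from eigenvector_in_invariant_subspace[OF sym subV invV this]
    obtain u c where u: "u \<in> V" "norm u = 1" "X *v u = c *\<^sub>R u" by blast
    have "u \<notin> B" using u unfolding V_def by auto
    moreover have "P (insert u B)"
      using PB u unfolding P_def V_def
      by (auto simp: pairwise_insert orthogonal_def inner_commute)
    ultimately show False using max[of "insert u B"] fin by simp
  qed
  have "span B = UNIV"
  proof -
    have "x \<in> span B" for x
    proof -
      obtain y z where yz: "y \<in> span B" "\<And>w. w \<in> span B \<Longrightarrow> orthogonal z w" "x = y + z"
        using orthogonal_subspace_decomp_exists[of B x] by blast
      then have "z \<in> V" unfolding V_def
        by (auto simp: orthogonal_def inner_commute span_base)
      then show ?thesis using yz V0 by simp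
    qed
    then show ?thesis by blast
  qed
  then have "card B = CARD('n)"
    using ind[OF PB] by (metis DIM_cart DIM_real dim_UNIV dim_eq_card dim_span mult_1_right)
  then obtain f where f: "bij_betw f (UNIV :: 'n set) B"
    using fin by (metis bij_betw_iff_card finite_class.finite_UNIV)
  have fB: "f a \<in> B" for a using f bij_betwE by fastforce
  have "orthonormal_frame f"
    unfolding orthonormal_frame_def
  proof (intro allI)
    fix a b
    show "f a \<bullet> f b = (if a = b then 1 else 0)"
    proof (cases "a = b")
      case True
      then show ?thesis using PB fB[of b] by (simp add: P_def dot_square_norm)
    next
      case False
      then have "f a \<noteq> f b" using f by (metis UNIV_I bij_betw_def inj_onD)
      then show ?thesis using PB fB False
        by (simp add: P_def pairwise_def orthogonal_def)
    qed
  qed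
  moreover have "\<forall>a. \<exists>c. X *v f a = c *\<^sub>R f a" using PB fB by (auto simp: P_def)
  then obtain l where "\<forall>a. X *v f a = l a *\<^sub>R f a" by metis
  ultimately show thesis using that unfolding eigenframe_def by blast
qed

section \<open>Traces and functional calculus in an eigenframe\<close>

lemma parseval:
  fixes f :: "'n \<Rightarrow> real^'n"
  assumes "orthonormal_frame f"
  shows "x \<bullet> y = (\<Sum>a\<in>UNIV. (f a \<bullet> x) * (f a \<bullet> y))"
proof -
  define Q :: "real^'n^'n" where "Q = (\<chi> a. f a)"
  have comp: "(Q *v z) $ a = f a \<bullet> z" for z a
    by (simp add: Q_def matrix_vector_mul_component)
  have "Q ** transpose Q = mat 1"
    using assms unfolding orthonormal_frame_def
    by (simp add: vec_eq_iff matrix_matrix_mult_def transpose_def mat_def Q_def inner_vec_def)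
  then have "transpose Q ** Q = mat 1" by (simp add: matrix_left_right_inverse)
  then have "x \<bullet> y = x \<bullet> (transpose Q *v (Q *v y))"
    by (simp add: matrix_vector_mul_assoc del: transpose_matrix_vector)
  also have "\<dots> = (Q *v x) \<bullet> (Q *v y)"
    by (metis dot_lmul_matrix inner_commute transpose_matrix_vector)
  finally show ?thesis by (simp add: inner_vec_def comp)
qed

lemma trace_frame:
  fixes f :: "'n \<Rightarrow> real^'n"
  assumes "orthonormal_frame f"
  shows "trace Y = (\<Sum>a\<in>UNIV. f a \<bullet> (Y *v f a))"
proof -
  have d: "(\<Sum>a\<in>UNIV. f a $ i * f a $ j) = (if i = j then 1 else 0)" for i j
    using parseval[OF assms, of "axis i 1" "axis j 1"] by (auto simp: inner_axis) (auto simp: axis_def split: if_splits)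
  have "(\<Sum>a\<in>UNIV. f a \<bullet> (Y *v f a)) = (\<Sum>a\<in>UNIV. \<Sum>i\<in>UNIV. \<Sum>j\<in>UNIV. Y $ i $ j * (f a $ i * f a $ j))"
    by (simp add: inner_vec_def matrix_vector_mult_def sum_distrib_left mult_ac)
  also have "\<dots> = (\<Sum>i\<in>UNIV. \<Sum>j\<in>UNIV. \<Sum>a\<in>UNIV. Y $ i $ j * (f a $ i * f a $ j))"
    by (subst sum.swap, rule sum.cong[OF refl], rule sum.swap)
  also have "\<dots> = (\<Sum>i\<in>UNIV. \<Sum>j\<in>UNIV. Y $ i $ j * (if i = j then 1 else 0))"
    by (simp add: d flip: sum_distrib_left)
  also have "\<dots> = trace Y" by (simp add: trace_def if_distrib cong: if_cong)
  finally show ?thesis by simp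
qed

lemma matrix_eq_on_frame:
  assumes f: "orthonormal_frame f" and eq: "\<And>a. X *v f a = Y *v f a"
  shows "X = Y"
proof -
  have "(X - Y) $ i \<bullet> (X - Y) $ i = 0" for i
  proof -
    have "f a \<bullet> (X - Y) $ i = 0" for a
    proof -
      have "f a \<bullet> (X - Y) $ i = ((X - Y) *v f a) $ i"
        by (simp add: matrix_vector_mul_component inner_commute)
      then show ?thesis by (simp add: matrix_vector_mult_diff_rdistrib eq)
    qed
    then show ?thesis by (subst parseval[OF f]) simp
  qed
  then show ?thesis by (simp add: vec_eq_iff)
qed

definition spectral_matrix :: "('n \<Rightarrow> real^'n) \<Rightarrow> ('n \<Rightarrow> real) \<Rightarrow> real^'n^'n" where
  "spectral_matrix f c = (\<Sum>a\<in>UNIV. c a *\<^sub>R (\<chi> i j. f a $ i * f a $ j))"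

lemma spectral_matrix_mult_vec:
  "spectral_matrix f c *v x = (\<Sum>a\<in>UNIV. (c a * (f a \<bullet> x)) *\<^sub>R f a)"
proof -
  have "(spectral_matrix f c *v x) $ i = (\<Sum>a\<in>UNIV. (c a * (f a \<bullet> x)) *\<^sub>R f a) $ i" for i
    unfolding spectral_matrix_def matrix_vector_mult_def inner_vec_def
    by (simp add: sum_component sum_distrib_left sum_distrib_right mult_ac)
      (rule sum.swap)
  then show ?thesis by (simp add: vec_eq_iff)
qed

lemma eigenframe_spectral_matrix:
  assumes "orthonormal_frame f"
  shows "eigenframe (spectral_matrix f c) f c"
proof -
  have "(\<Sum>a\<in>UNIV. (c a * (f a \<bullet> f b)) *\<^sub>R f a) = (\<Sum>a\<in>UNIV. if a = b then c b *\<^sub>R f b else 0)" for b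
    using assms unfolding orthonormal_frame_def by (intro sum.cong) auto
  then show ?thesis using assms by (simp add: eigenframe_def spectral_matrix_mult_vec)
qed

lemma eigenframe_unique:
  assumes "eigenframe X f c" "eigenframe Y f c"
  shows "X = Y"
  using assms matrix_eq_on_frame[of f X Y] by (simp add: eigenframe_def)

lemma sym_matrix_spectral_matrix: "sym_matrix (spectral_matrix f c)"
  by (simp add: sym_matrix_def spectral_matrix_def vec_eq_iff transpose_def sum_component mult.commute)

text \<open>Powers of \<open>X\<close> are spectral matrices over the frame of \<open>X\<close>, so the exponential series of
  matrices reduces to one scalar series per eigenvalue.\<close>

lemma mat_exp_eigenframe:
  fixes X :: "real^'n^'n"
  assumes X: "eigenframe X f l"
  shows "mat_exp X = spectral_matrix f (\<lambda>a. exp (l a))"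
proof -
  have f: "orthonormal_frame f" using X by (simp add: eigenframe_def)
  have "eigenframe (mat_power X k) f (\<lambda>a. l a ^ k)" for k
  proof (induction k)
    case 0
    then show ?case using f by (simp add: eigenframe_def)
  next
    case (Suc k)
    then show ?case using X
      by (simp add: eigenframe_def matrix_vector_mult_scaleR mult.commute flip: matrix_vector_mul_assoc)
  qed
  then have power: "mat_power X k = spectral_matrix f (\<lambda>a. l a ^ k)" for k
    by (rule eigenframe_unique[OF _ eigenframe_spectral_matrix[OF f]])
  have "(\<lambda>k. (l a ^ k /\<^sub>R fact k)) sums exp (l a)" for a by (rule exp_converges)
  then have "(\<lambda>k. \<Sum>a\<in>UNIV. (l a ^ k /\<^sub>R fact k) *\<^sub>R (\<chi> i j. f a $ i * f a $ j))
     sums (\<Sum>a\<in>UNIV. exp (l a) *\<^sub>R (\<chi> i j. f a $ i * f a $ j))"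
    by (intro sums_sum sums_scaleR_left)
  then have "(\<lambda>k. (1 / fact k) *\<^sub>R mat_power X k) sums spectral_matrix f (\<lambda>a. exp (l a))"
    unfolding power spectral_matrix_def by (simp add: scaleR_sum_right divide_inverse)
  then show ?thesis unfolding mat_exp_def by (rule sums_unique[symmetric])
qed

lemma trace_eigenframe_mult:
  assumes "eigenframe X f c"
  shows "trace (X ** Y) = (\<Sum>a\<in>UNIV. c a * (f a \<bullet> (Y *v f a)))"
proof -
  have "trace (X ** Y) = trace (Y ** X)" by (rule trace_mul_sym)
  also have "\<dots> = (\<Sum>a\<in>UNIV. f a \<bullet> (Y *v (X *v f a)))"
    using assms by (subst trace_frame[of f]) (auto simp: eigenframe_def simp flip: matrix_vector_mul_assoc)
  finally show ?thesis using assms by (simp add: eigenframe_def matrix_vector_mult_scaleR)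
qed

lemma trace_eigenframe:
  assumes "eigenframe X f c"
  shows "trace X = (\<Sum>a\<in>UNIV. c a)"
proof -
  have "f a \<bullet> f a = 1" for a using assms by (simp add: eigenframe_def orthonormal_frame_def)
  then show ?thesis using trace_eigenframe_mult[OF assms, of "mat 1"] by simp
qed

lemma inner_sym_matrix_eq_trace:
  "sym_matrix X \<Longrightarrow> X \<bullet> Y = trace (X ** Y)"
proof -
  assume "sym_matrix X"
  then have "X $ i $ j = X $ j $ i" for i j
    unfolding sym_matrix_def by (metis transpose_def vec_lambda_beta)
  then show ?thesis
    unfolding inner_vec_def trace_def matrix_matrix_mult_def
    by (subst sum.swap) simp
qed

lemma sym_matrix_add: "sym_matrix X \<Longrightarrow> sym_matrix Y \<Longrightarrow> sym_matrix (X + Y)"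
  and sym_matrix_diff: "sym_matrix X \<Longrightarrow> sym_matrix Y \<Longrightarrow> sym_matrix (X - Y)"
  and sym_matrix_scaleR: "sym_matrix X \<Longrightarrow> sym_matrix (c *\<^sub>R X)"
  by (auto simp: sym_matrix_def transpose_def vec_eq_iff)

lemma norm_sym_matrix_eigenframe:
  assumes "sym_matrix X" "eigenframe X f c"
  shows "(norm X)\<^sup>2 = (\<Sum>a\<in>UNIV. (c a)\<^sup>2)"
proof -
  have "f a \<bullet> (X *v f a) = c a" for a
    using assms by (simp add: eigenframe_def orthonormal_frame_def)
  then show ?thesis
    using trace_eigenframe_mult[OF assms(2), of X] inner_sym_matrix_eq_trace[OF assms(1), of X]
    unfolding power2_norm_eq_inner by (simp add: power2_eq_square)
qed

section \<open>The spectrahedron and the moment body\<close>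

lemma spectrahedronD:
  assumes "X \<in> spectrahedron"
  shows "sym_matrix X" "0 \<le> u \<bullet> (X *v u)" "trace X = 1"
  using assms by (auto simp: spectrahedron_def psd_matrix_def)

lemma spectral_matrix_in_spectrahedron:
  assumes f: "orthonormal_frame f" and c: "\<And>a. c a \<ge> 0" and s: "sum c UNIV = 1"
  shows "spectral_matrix f c \<in> spectrahedron"
proof -
  have "u \<bullet> (spectral_matrix f c *v u) = (\<Sum>a\<in>UNIV. c a * (f a \<bullet> u)\<^sup>2)" for u
    by (simp add: spectral_matrix_mult_vec inner_sum_right power2_eq_square inner_commute mult_ac)
  then show ?thesis
    using trace_eigenframe[OF eigenframe_spectral_matrix[OF f, of c]] c s
    by (simp add: spectrahedron_def psd_matrix_def sym_matrix_spectral_matrix sum_nonneg)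
qed

lemma norm_spectrahedron_le_1:
  assumes "X \<in> spectrahedron"
  shows "norm X \<le> 1"
proof -
  note X = spectrahedronD[OF assms]
  obtain f l where fl: "eigenframe X f l" using spectral_theorem[OF X(1)] .
  have "f a \<bullet> (X *v f a) = l a" for a
    using fl by (simp add: eigenframe_def orthonormal_frame_def)
  then have l0: "l a \<ge> 0" for a using X(2) by metis
  have s: "sum l UNIV = 1" using trace_eigenframe[OF fl] X(3) by simp
  have l1: "l a \<le> 1" for a
    using member_le_sum[of a UNIV l] l0 s by simp
  have "(norm X)\<^sup>2 = (\<Sum>a\<in>UNIV. (l a)\<^sup>2)" by (rule norm_sym_matrix_eigenframe[OF X(1) fl])
  also have "\<dots> \<le> (\<Sum>a\<in>UNIV. l a)"
    using l0 l1 by (intro sum_mono) (simp add: power2_eq_square mult_left_le)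
  finally have "(norm X)\<^sup>2 \<le> 1" using s by simp
  then show ?thesis by (simp add: abs_square_le_1)
qed

lemma abs_trace_spectrahedron_le:
  assumes "X \<in> spectrahedron"
  shows "\<bar>trace (X ** K)\<bar> \<le> norm K"
proof -
  have "\<bar>trace (X ** K)\<bar> \<le> norm X * norm K"
    using Cauchy_Schwarz_ineq2[of X K] inner_sym_matrix_eq_trace[OF spectrahedronD(1)[OF assms]]
    by simp
  also have "\<dots> \<le> norm K"
    using norm_spectrahedron_le_1[OF assms] by (simp add: mult_left_le_one_le)
  finally show ?thesis .
qed

lemma compact_spectrahedron: "compact (spectrahedron :: (real^'n^'n) set)"
proof -
  have "bounded (spectrahedron :: (real^'n^'n) set)"
    using norm_spectrahedron_le_1 by (auto simp: bounded_iff)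
  moreover have "closed (spectrahedron :: (real^'n^'n) set)"
  proof -
    have tr: "transpose X = (\<chi> i j. X $ j $ i)" for X :: "real^'n^'n"
      by (simp add: transpose_def)
    have eq: "spectrahedron = {X::real^'n^'n. transpose X = X} \<inter> {X. \<forall>u. 0 \<le> u \<bullet> (X *v u)} \<inter> {X. trace X = 1}"
      by (auto simp: spectrahedron_def psd_matrix_def sym_matrix_def)
    have "closed {X::real^'n^'n. transpose X = X}"
      unfolding tr by (intro closed_Collect_eq continuous_intros)
    moreover have "closed {X::real^'n^'n. \<forall>u. 0 \<le> u \<bullet> (X *v u)}"
      unfolding matrix_vector_mult_def inner_vec_def
      by (intro closed_Collect_all closed_Collect_le continuous_intros) 
    moreover have "closed {X::real^'n^'n. trace X = 1}"
      unfolding trace_def by (intro closed_Collect_eq continuous_intros)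
    ultimately show ?thesis unfolding eq by (intro closed_Int)
  qed
  ultimately show ?thesis by (simp add: compact_eq_bounded_closed)
qed

lemma compact_moment_body: "compact (moment_body A)"
  unfolding moment_body_def moment_map_def trace_def matrix_matrix_mult_def
  by (intro compact_continuous_image compact_spectrahedron continuous_intros)

text \<open>The segment from a point outside \<open>S\<close> to a point of \<open>S\<close> crosses the frontier.\<close>

lemma infdist_frontier:
  fixes b :: "'a::euclidean_space"
  assumes "b \<notin> S" "z \<in> S"
  shows "infdist b (frontier S) \<le> dist b z"
proof -
  have "closed_segment b z \<inter> frontier S \<noteq> {}"
    using assms by (intro connected_Int_frontier) auto
  then obtain p where p: "p \<in> closed_segment b z" "p \<in> frontier S" by blast
  then have "infdist b (frontier S) \<le> dist b p" by (simp add: infdist_le)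
  also have "\<dots> \<le> dist b z" using dist_in_closed_segment[OF p(1)] by (simp add: dist_commute)
  finally show ?thesis .
qed

lemma infdist_frontier_pos:
  fixes b :: "'a::euclidean_space"
  assumes "compact S" "S \<noteq> {}" "b \<notin> S"
  shows "0 < infdist b (frontier S)"
proof -
  have "frontier S \<noteq> {}"
    using assms by (metis compact_imp_bounded frontier_eq_empty not_bounded_UNIV)
  moreover have "b \<notin> frontier S"
    using assms by (metis compact_imp_closed frontier_subset_closed subsetD)
  ultimately show ?thesis
    by (metis frontier_closed in_closed_iff_infdist_zero infdist_nonneg less_eq_real_def)
qed


section \<open>Gibbs states\<close>

definition log_partition :: "real^'n^'n \<Rightarrow> real" where
  "log_partition X = ln (trace (mat_exp X))"

definition gibbs :: "real^'n^'n \<Rightarrow> real^'n^'n" where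
  "gibbs X = (1 / trace (mat_exp X)) *\<^sub>R mat_exp X"

lemma trace_mat_exp_eigenframe:
  assumes "eigenframe X f l"
  shows "trace (mat_exp X) = (\<Sum>a\<in>UNIV. exp (l a))"
  using assms trace_eigenframe[OF eigenframe_spectral_matrix[of f]]
  by (simp add: mat_exp_eigenframe eigenframe_def)

lemma exp_log_partition:
  assumes "eigenframe X f l"
  shows "exp (log_partition X) = (\<Sum>a\<in>UNIV. exp (l a))"
  unfolding log_partition_def trace_mat_exp_eigenframe[OF assms]
  by (simp add: sum_pos)

lemma eigenvalue_le_log_partition:
  assumes "eigenframe X f l"
  shows "l a \<le> log_partition X"
proof -
  have "exp (l a) \<le> exp (log_partition X)"
    unfolding exp_log_partition[OF assms] by (rule member_le_sum) auto
  then show ?thesis by simp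
qed

lemma gibbs_eigenframe:
  assumes X: "eigenframe X f l"
  shows "eigenframe (gibbs X) f (\<lambda>a. exp (l a - log_partition X))"
    and "(\<Sum>a\<in>UNIV. exp (l a - log_partition X)) = 1"
proof -
  have pos: "(\<Sum>a\<in>UNIV. exp (l a)) > 0" by (simp add: sum_pos)
  show "eigenframe (gibbs X) f (\<lambda>a. exp (l a - log_partition X))"
    using eigenframe_spectral_matrix[of f "\<lambda>a. exp (l a)"] X
    by (simp add: eigenframe_def gibbs_def mat_exp_eigenframe[OF X] exp_diff exp_log_partition[OF X]
        trace_mat_exp_eigenframe[OF X, unfolded mat_exp_eigenframe[OF X]]
        scaleR_matrix_vector_assoc[symmetric])
  show "(\<Sum>a\<in>UNIV. exp (l a - log_partition X)) = 1"
    using pos by (simp add: exp_diff exp_log_partition[OF X] flip: sum_divide_distrib)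
qed

lemma gibbs_in_spectrahedron:
  assumes "sym_matrix X"
  shows "gibbs X \<in> spectrahedron"
proof -
  obtain f l where X: "eigenframe X f l" using spectral_theorem[OF assms] .
  then have f: "orthonormal_frame f" by (simp add: eigenframe_def)
  show ?thesis
    using eigenframe_unique[OF gibbs_eigenframe(1)[OF X] eigenframe_spectral_matrix[OF f]]
      spectral_matrix_in_spectrahedron[OF f, of "\<lambda>a. exp (l a - log_partition X)"]
      gibbs_eigenframe(2)[OF X]
    by simp
qed

text \<open>The matrix entries of \<open>B - A\<close> between an eigenvector of \<open>A\<close> and one of \<open>B\<close> are
  \<open>(m b - l a) * (f a \<bullet> g b)\<close>, so in mixed coordinates \<open>B - A\<close> acts by multiplication with a
  scalar although \<open>A\<close> and \<open>B\<close> need not commute.\<close>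

lemma frame_expansion_of_difference:
  assumes A: "sym_matrix A" "eigenframe A f l" and B: "sym_matrix B" "eigenframe B g m"
  shows "f a \<bullet> ((B - A) *v f a) = (\<Sum>b\<in>UNIV. (f a \<bullet> g b)\<^sup>2 * (m b - l a))"
    and "f a \<bullet> ((B - A) ** (B - A) *v f a) = (\<Sum>b\<in>UNIV. (f a \<bullet> g b)\<^sup>2 * (m b - l a)\<^sup>2)"
proof -
  have g: "orthonormal_frame g" using B by (simp add: eigenframe_def)
  have coeff: "g b \<bullet> ((B - A) *v f a) = (m b - l a) * (f a \<bullet> g b)" for b
    using A(2) B(2)
    by (simp add: matrix_vector_mult_diff_rdistrib inner_diff_right sym_matrix_inner[OF B(1)]
        eigenframe_def inner_commute algebra_simps)
  show "f a \<bullet> ((B - A) *v f a) = (\<Sum>b\<in>UNIV. (f a \<bullet> g b)\<^sup>2 * (m b - l a))"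
    by (subst parseval[OF g]) (simp add: coeff power2_eq_square inner_commute mult_ac)
  have "f a \<bullet> ((B - A) ** (B - A) *v f a) = ((B - A) *v f a) \<bullet> ((B - A) *v f a)"
    using sym_matrix_inner[OF sym_matrix_diff[OF B(1) A(1)]]
    by (simp flip: matrix_vector_mul_assoc)
  also have "\<dots> = (\<Sum>b\<in>UNIV. (f a \<bullet> g b)\<^sup>2 * (m b - l a)\<^sup>2)"
    by (subst parseval[OF g]) (simp add: coeff power2_eq_square mult_ac)
  finally show "f a \<bullet> ((B - A) ** (B - A) *v f a) = (\<Sum>b\<in>UNIV. (f a \<bullet> g b)\<^sup>2 * (m b - l a)\<^sup>2)" .
qed

lemma trace_mult_uminus: "trace (X ** (- Y)) = - trace (X ** (Y :: real^'n^'n))"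
  by (simp add: trace_def matrix_matrix_mult_def sum_negf)

lemma trace_mult_scaleR: "trace (X ** (c *\<^sub>R Y)) = c * trace (X ** (Y :: real^'n^'n))"
  by (simp add: trace_def matrix_matrix_mult_def sum_distrib_left mult_ac)

text \<open>Subtracting the log-partition values from the eigenvalues turns \<open>exp (y a)\<close> and \<open>exp (x b)\<close>
  into the eigenvalues of the Gibbs states; the differences \<open>x b - y a\<close> then represent \<open>B - A\<close>
  centred at \<open>c\<close>.\<close>

lemma gibbs_moments:
  fixes A B :: "real^'n^'n"
  assumes A: "sym_matrix A" "eigenframe A f l" and B: "sym_matrix B" "eigenframe B g m"
  defines "c \<equiv> log_partition B - log_partition A"
    and "x \<equiv> \<lambda>b. m b - log_partition B" and "y \<equiv> \<lambda>a. l a - log_partition A"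
  shows "(\<Sum>a\<in>UNIV. \<Sum>b\<in>UNIV. (f a \<bullet> g b)\<^sup>2 * exp (y a)) = 1"
    and "(\<Sum>a\<in>UNIV. \<Sum>b\<in>UNIV. (f a \<bullet> g b)\<^sup>2 * (exp (y a) * (x b - y a))) = trace (gibbs A ** (B - A)) - c"
    and "(\<Sum>a\<in>UNIV. \<Sum>b\<in>UNIV. (f a \<bullet> g b)\<^sup>2 * (exp (y a) * (x b - y a)\<^sup>2)) =
      trace (gibbs A ** ((B - A) ** (B - A))) - 2 * c * trace (gibbs A ** (B - A)) + c\<^sup>2"
proof -
  note G = gibbs_eigenframe[OF A(2)]
  have "f a \<bullet> f a = 1" for a using A(2) by (simp add: eigenframe_def orthonormal_frame_def)
  then have w: "(\<Sum>b\<in>UNIV. (f a \<bullet> g b)\<^sup>2) = 1" for a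
    using parseval[of g "f a" "f a"] B(2)
    by (simp add: eigenframe_def power2_eq_square inner_commute)
  have G2: "(\<Sum>a\<in>UNIV. exp (y a)) = 1" using G(2) by (simp add: y_def)
  have G1: "eigenframe (gibbs A) f (\<lambda>a. exp (y a))" using G(1) by (simp add: y_def)
  show 0: "(\<Sum>a\<in>UNIV. \<Sum>b\<in>UNIV. (f a \<bullet> g b)\<^sup>2 * exp (y a)) = 1"
    using w G2 by (simp flip: sum_distrib_right)
  have t1: "trace (gibbs A ** (B - A)) = (\<Sum>a\<in>UNIV. \<Sum>b\<in>UNIV. (f a \<bullet> g b)\<^sup>2 * (exp (y a) * (m b - l a)))"
    unfolding trace_eigenframe_mult[OF G1] frame_expansion_of_difference(1)[OF A B]
    by (simp add: sum_distrib_left mult_ac)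
  have t2: "trace (gibbs A ** ((B - A) ** (B - A))) =
      (\<Sum>a\<in>UNIV. \<Sum>b\<in>UNIV. (f a \<bullet> g b)\<^sup>2 * (exp (y a) * (m b - l a)\<^sup>2))"
    unfolding trace_eigenframe_mult[OF G1] frame_expansion_of_difference(2)[OF A B]
    by (simp add: sum_distrib_left mult_ac)
  have xy: "x b - y a = (m b - l a) - c" for a b by (simp add: x_def y_def c_def)
  have "(\<Sum>a\<in>UNIV. \<Sum>b\<in>UNIV. (f a \<bullet> g b)\<^sup>2 * (exp (y a) * (x b - y a))) =
      (\<Sum>a\<in>UNIV. \<Sum>b\<in>UNIV. (f a \<bullet> g b)\<^sup>2 * (exp (y a) * (m b - l a)) - c * ((f a \<bullet> g b)\<^sup>2 * exp (y a)))"
    unfolding xy by (intro sum.cong refl) (simp add: algebra_simps)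
  also have "\<dots> = trace (gibbs A ** (B - A)) - c * 1"
    unfolding t1 0[symmetric] by (simp only: sum_subtractf sum_distrib_left)
  finally show "(\<Sum>a\<in>UNIV. \<Sum>b\<in>UNIV. (f a \<bullet> g b)\<^sup>2 * (exp (y a) * (x b - y a))) = trace (gibbs A ** (B - A)) - c"
    by simp
  have "(\<Sum>a\<in>UNIV. \<Sum>b\<in>UNIV. (f a \<bullet> g b)\<^sup>2 * (exp (y a) * (x b - y a)\<^sup>2)) =
      (\<Sum>a\<in>UNIV. \<Sum>b\<in>UNIV. (f a \<bullet> g b)\<^sup>2 * (exp (y a) * (m b - l a)\<^sup>2)
        - (2 * c) * ((f a \<bullet> g b)\<^sup>2 * (exp (y a) * (m b - l a))) + c\<^sup>2 * ((f a \<bullet> g b)\<^sup>2 * exp (y a)))"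
    unfolding xy by (intro sum.cong refl) (simp add: power2_eq_square algebra_simps)
  also have "\<dots> = trace (gibbs A ** ((B - A) ** (B - A))) - 2 * c * trace (gibbs A ** (B - A)) + c\<^sup>2 * 1"
    unfolding t1 t2 0[symmetric] by (simp only: sum_subtractf sum.distrib sum_distrib_left)
  finally show "(\<Sum>a\<in>UNIV. \<Sum>b\<in>UNIV. (f a \<bullet> g b)\<^sup>2 * (exp (y a) * (x b - y a)\<^sup>2)) =
      trace (gibbs A ** ((B - A) ** (B - A))) - 2 * c * trace (gibbs A ** (B - A)) + c\<^sup>2"
    by simp
qed

text \<open>The weights \<open>w a b * exp (y a)\<close> and \<open>w a b * exp (x b)\<close> are two probability distributions on
  pairs of indices (the Nussbaum-Szkola distributions of the two Gibbs states), with log-likelihood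
  ratio \<open>x b - y a\<close>. The lemma records its first two moments under both, which reduces the
  comparison of two Gibbs states to scalar inequalities.\<close>

lemma gibbs_coupling:
  fixes A B :: "real^'n^'n"
  assumes A: "sym_matrix A" and B: "sym_matrix B"
  defines "c \<equiv> log_partition B - log_partition A"
  obtains w :: "'n \<Rightarrow> 'n \<Rightarrow> real" and x y
  where "\<And>a b. w a b \<ge> 0"
    and "(\<Sum>a\<in>UNIV. \<Sum>b\<in>UNIV. w a b * exp (y a)) = 1"
    and "(\<Sum>a\<in>UNIV. \<Sum>b\<in>UNIV. w a b * exp (x b)) = 1"
    and "(\<Sum>a\<in>UNIV. \<Sum>b\<in>UNIV. w a b * (exp (y a) * (x b - y a))) = trace (gibbs A ** (B - A)) - c"
    and "(\<Sum>a\<in>UNIV. \<Sum>b\<in>UNIV. w a b * (exp (x b) * (x b - y a))) = trace (gibbs B ** (B - A)) - c"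
    and "(\<Sum>a\<in>UNIV. \<Sum>b\<in>UNIV. w a b * (exp (y a) * (x b - y a)\<^sup>2)) =
      trace (gibbs A ** ((B - A) ** (B - A))) - 2 * c * trace (gibbs A ** (B - A)) + c\<^sup>2"
    and "(\<Sum>a\<in>UNIV. \<Sum>b\<in>UNIV. w a b * (exp (x b) * (x b - y a)\<^sup>2)) =
      trace (gibbs B ** ((B - A) ** (B - A))) - 2 * c * trace (gibbs B ** (B - A)) + c\<^sup>2"
proof -
  obtain f l where f: "eigenframe A f l" using spectral_theorem[OF A] .
  obtain g m where g: "eigenframe B g m" using spectral_theorem[OF B] .
  let ?w = "\<lambda>a b. (f a \<bullet> g b)\<^sup>2"
  let ?x = "\<lambda>b. m b - log_partition B" and ?y = "\<lambda>a. l a - log_partition A"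
  note AB = gibbs_moments[OF A f B g, folded c_def]
  note BA = gibbs_moments[OF B g A f]
  have neg: "A - B = - (B - A)" by simp
  have sq: "(- X) ** (- X) = X ** X" for X :: "real^'n^'n"
    by (simp add: matrix_matrix_mult_def)
  show thesis
  proof (rule that[of ?w ?y ?x])
    show "(\<Sum>a\<in>UNIV. \<Sum>b\<in>UNIV. ?w a b * exp (?x b)) = 1"
      by (subst sum.swap) (use BA(1) in \<open>simp add: inner_commute\<close>)
    have "(\<Sum>a\<in>UNIV. \<Sum>b\<in>UNIV. ?w a b * (exp (?x b) * (?x b - ?y a)))
        = - (\<Sum>b\<in>UNIV. \<Sum>a\<in>UNIV. (g b \<bullet> f a)\<^sup>2 * (exp (?x b) * (?y a - ?x b)))"
      by (subst sum.swap) (simp add: inner_commute algebra_simps flip: sum_negf)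
    then show "(\<Sum>a\<in>UNIV. \<Sum>b\<in>UNIV. ?w a b * (exp (?x b) * (?x b - ?y a))) = trace (gibbs B ** (B - A)) - c"
      unfolding BA(2) neg trace_mult_uminus by (simp add: c_def)
    have "(\<Sum>a\<in>UNIV. \<Sum>b\<in>UNIV. ?w a b * (exp (?x b) * (?x b - ?y a)\<^sup>2))
        = (\<Sum>b\<in>UNIV. \<Sum>a\<in>UNIV. (g b \<bullet> f a)\<^sup>2 * (exp (?x b) * (?y a - ?x b)\<^sup>2))"
      by (subst sum.swap) (simp add: inner_commute power2_commute)
    then show "(\<Sum>a\<in>UNIV. \<Sum>b\<in>UNIV. ?w a b * (exp (?x b) * (?x b - ?y a)\<^sup>2)) =
      trace (gibbs B ** ((B - A) ** (B - A))) - 2 * c * trace (gibbs B ** (B - A)) + c\<^sup>2"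
      unfolding BA(3) neg trace_mult_uminus sq by (simp add: c_def power2_commute algebra_simps)
  qed (use AB in simp_all)
qed

section \<open>Smoothness of the log-partition function\<close>

text \<open>The convexity bound \<open>exp y * (x - y) \<le> exp x - exp y\<close>, summed over the coupling; the right-hand
  sides cancel since both distributions have total mass 1.\<close>

lemma log_partition_ge:
  fixes A B :: "real^'n^'n"
  assumes "sym_matrix A" "sym_matrix B"
  shows "trace (gibbs A ** (B - A)) \<le> log_partition B - log_partition A"
proof -
  obtain w :: "'n \<Rightarrow> 'n \<Rightarrow> real" and x y where w: "\<And>a b. w a b \<ge> 0"
    and y1: "(\<Sum>a\<in>UNIV. \<Sum>b\<in>UNIV. w a b * exp (y a)) = 1"
    and x1: "(\<Sum>a\<in>UNIV. \<Sum>b\<in>UNIV. w a b * exp (x b)) = 1"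
    and t: "(\<Sum>a\<in>UNIV. \<Sum>b\<in>UNIV. w a b * (exp (y a) * (x b - y a))) =
      trace (gibbs A ** (B - A)) - (log_partition B - log_partition A)"
    by (rule gibbs_coupling[OF assms]) (rule that, assumption+)
  have conv: "exp (y a) * (x b - y a) \<le> exp (x b) - exp (y a)" for a b
  proof -
    have "exp (y a) * (1 + (x b - y a)) \<le> exp (y a) * exp (x b - y a)"
      by (intro mult_left_mono exp_ge_add_one_self) simp
    then show ?thesis by (simp add: algebra_simps flip: exp_add)
  qed
  have "(\<Sum>a\<in>UNIV. \<Sum>b\<in>UNIV. w a b * (exp (y a) * (x b - y a)))
      \<le> (\<Sum>a\<in>UNIV. \<Sum>b\<in>UNIV. w a b * (exp (x b) - exp (y a)))"
    by (intro sum_mono mult_left_mono conv w)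
  also have "\<dots> = 0"
    using x1 y1 by (simp add: right_diff_distrib sum_subtractf)
  finally show ?thesis using t by simp
qed

lemma log_partition_le:
  assumes "sym_matrix A" "sym_matrix B"
  shows "log_partition B - log_partition A \<le> trace (gibbs B ** (B - A))"
proof -
  have "trace (gibbs B ** (- (B - A))) \<le> log_partition A - log_partition B"
    using log_partition_ge[OF assms(2,1)] by simp
  then show ?thesis unfolding trace_mult_uminus by simp
qed

text \<open>For \<open>u \<noteq> v\<close> this says that the logarithmic mean of \<open>exp u\<close> and \<open>exp v\<close> is at most their
  arithmetic mean.\<close>

lemma exp_slope_le_mean:
  fixes u v :: real
  shows "(exp u - exp v) * (u - v) \<le> (exp u + exp v) / 2 * (u - v)\<^sup>2"
proof -
  have base: "exp d - 1 \<le> (exp d + 1) / 2 * d" if "d \<ge> 0" for d :: real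
  proof -
    define g :: "real \<Rightarrow> real" where "g = (\<lambda>d. d * (exp d + 1) - 2 * (exp d - 1))"
    have "g 0 \<le> g d"
    proof (rule DERIV_nonneg_imp_nondecreasing[OF that])
      fix z :: real
      have "(g has_real_derivative (1 + (z - 1) * exp z)) (at z)"
        unfolding g_def by (auto intro!: derivative_eq_intros simp: algebra_simps)
      moreover have "1 + (z - 1) * exp z \<ge> 0"
      proof -
        have "(1 - z) * exp z \<le> exp (- z) * exp z"
          using exp_ge_add_one_self[of "- z"] by (intro mult_right_mono) auto
        then show ?thesis by (simp add: algebra_simps flip: exp_add)
      qed
      ultimately show "\<exists>D. (g has_real_derivative D) (at z) \<and> 0 \<le> D" by blast
    qed
    then show ?thesis by (simp add: g_def algebra_simps)
  qed
  have ordered: "(exp u - exp v) * (u - v) \<le> (exp u + exp v) / 2 * (u - v)\<^sup>2" if "v \<le> u" for u v :: real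
  proof -
    define d where "d = u - v"
    have u: "u = v + d" by (simp add: d_def)
    have "(exp v * d) * (exp d - 1) \<le> (exp v * d) * ((exp d + 1) / 2 * d)"
      using that by (intro mult_left_mono base) (auto simp: d_def)
    then show ?thesis unfolding u by (simp add: exp_add power2_eq_square field_simps)
  qed
  show ?thesis
    using ordered[of v u] ordered[of u v]
    by (cases "v \<le> u") (auto simp: power2_eq_square algebra_simps)
qed

text \<open>In an eigenframe of \<open>K\<close> the left-hand side is the variance of the eigenvalues \<open>t a\<close> under the
  probabilities \<open>v a\<close>. Comparing \<open>\<Sum>a b. v a * v b * (t a + t b)\<^sup>2\<close> with its diagonal bounds it by
  \<open>\<Sum>a. 2 * v a * (1 - v a) * (t a)\<^sup>2\<close>, and \<open>v * (1 - v) \<le> 1 / 4\<close>. The constant \<open>1 / 2\<close> is what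
  admits a gradient step of length 2.\<close>

lemma variance_spectrahedron_le:
  fixes X K :: "real^'n^'n"
  assumes X: "X \<in> spectrahedron" and K: "sym_matrix K"
  shows "trace (X ** (K ** K)) - (trace (X ** K))\<^sup>2 \<le> (norm K)\<^sup>2 / 2"
proof -
  obtain f t where ft: "eigenframe K f t" using spectral_theorem[OF K] .
  define v where "v a = f a \<bullet> (X *v f a)" for a
  have v0: "v a \<ge> 0" for a unfolding v_def by (rule spectrahedronD(2)[OF X])
  have v1: "sum v UNIV = 1"
    using spectrahedronD(3)[OF X] trace_frame[of f X] ft by (simp add: eigenframe_def v_def)
  have m1: "trace (X ** K) = (\<Sum>a\<in>UNIV. v a * t a)"
    using trace_eigenframe_mult[OF ft, of X] by (simp add: trace_mul_sym[of X] v_def mult.commute)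
  have "eigenframe (K ** K) f (\<lambda>a. (t a)\<^sup>2)"
    using ft by (simp add: eigenframe_def power2_eq_square matrix_vector_mult_scaleR
        flip: matrix_vector_mul_assoc)
  from trace_eigenframe_mult[OF this, of X]
  have m2: "trace (X ** (K ** K)) = (\<Sum>a\<in>UNIV. v a * (t a)\<^sup>2)"
    by (simp add: trace_mul_sym[of X] v_def mult.commute)
  have "(\<Sum>a\<in>UNIV. 4 * (v a * v a * (t a)\<^sup>2)) \<le> (\<Sum>a\<in>UNIV. \<Sum>b\<in>UNIV. v a * v b * (t a + t b)\<^sup>2)"
  proof (rule sum_mono)
    fix a
    have "v a * v a * (t a + t a)\<^sup>2 \<le> (\<Sum>b\<in>UNIV. v a * v b * (t a + t b)\<^sup>2)"
      using v0 by (intro member_le_sum) auto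
    then show "4 * (v a * v a * (t a)\<^sup>2) \<le> (\<Sum>b\<in>UNIV. v a * v b * (t a + t b)\<^sup>2)"
      by (simp add: power2_eq_square algebra_simps)
  qed
  also have "\<dots> = (\<Sum>a\<in>UNIV. \<Sum>b\<in>UNIV. (v a * (t a)\<^sup>2) * v b + 2 * ((v a * t a) * (v b * t b)) + v a * (v b * (t b)\<^sup>2))"
    by (intro sum.cong refl) (simp add: power2_eq_square algebra_simps)
  also have "\<dots> = (\<Sum>a\<in>UNIV. v a * (t a)\<^sup>2) * sum v UNIV
      + 2 * ((\<Sum>a\<in>UNIV. v a * t a) * (\<Sum>b\<in>UNIV. v b * t b)) + sum v UNIV * (\<Sum>b\<in>UNIV. v b * (t b)\<^sup>2)"
    unfolding sum_product by (simp only: sum.distrib sum_distrib_left)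
  finally have "4 * (\<Sum>a\<in>UNIV. v a * v a * (t a)\<^sup>2) \<le> 2 * trace (X ** (K ** K)) + 2 * (trace (X ** K))\<^sup>2"
    unfolding v1 m1 m2 by (simp add: sum_distrib_left power2_eq_square)
  then have "trace (X ** (K ** K)) - (trace (X ** K))\<^sup>2
      \<le> 2 * (\<Sum>a\<in>UNIV. v a * (t a)\<^sup>2) - 2 * (\<Sum>a\<in>UNIV. v a * v a * (t a)\<^sup>2)"
    unfolding m2 by linarith
  also have "\<dots> = (\<Sum>a\<in>UNIV. 2 * (v a * (1 - v a)) * (t a)\<^sup>2)"
    by (simp add: sum_distrib_left algebra_simps flip: sum_subtractf)
  also have "\<dots> \<le> (\<Sum>a\<in>UNIV. 1 / 2 * (t a)\<^sup>2)"
  proof (intro sum_mono mult_right_mono)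
    fix a
    have "0 \<le> (v a - 1 / 2)\<^sup>2" by simp
    then show "2 * (v a * (1 - v a)) \<le> 1 / 2" by (simp add: power2_eq_square algebra_simps)
  qed simp
  finally show ?thesis
    unfolding norm_sym_matrix_eigenframe[OF K ft] by (simp add: sum_divide_distrib)
qed

text \<open>Under the coupling, \<open>d\<close> is at most the mean of the second moments of \<open>B - A\<close> about
  \<open>c\<close> in the two states. Each is a variance plus the squared distance of \<open>c\<close> from a mean; as \<open>c\<close>
  lies between the two means, which are \<open>d\<close> apart, these squares add up to at most \<open>d\<^sup>2\<close>.\<close>

lemma gibbs_increment_le:
  fixes A B :: "real^'n^'n"
  assumes A: "sym_matrix A" and B: "sym_matrix B"
  defines "d \<equiv> trace (gibbs B ** (B - A)) - trace (gibbs A ** (B - A))"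
  shows "0 \<le> d" and "d \<le> (norm (B - A))\<^sup>2 / 2 + d\<^sup>2 / 2"
proof -
  define c where "c = log_partition B - log_partition A"
  let ?K = "B - A"
  have c1: "trace (gibbs A ** ?K) \<le> c" unfolding c_def by (rule log_partition_ge[OF A B])
  have c2: "c \<le> trace (gibbs B ** ?K)" unfolding c_def by (rule log_partition_le[OF A B])
  show "0 \<le> d" using c1 c2 by (simp add: d_def)
  obtain w :: "'n \<Rightarrow> 'n \<Rightarrow> real" and x y where w: "\<And>a b. w a b \<ge> 0"
    and a1: "(\<Sum>a\<in>UNIV. \<Sum>b\<in>UNIV. w a b * (exp (y a) * (x b - y a))) = trace (gibbs A ** ?K) - c"
    and b1: "(\<Sum>a\<in>UNIV. \<Sum>b\<in>UNIV. w a b * (exp (x b) * (x b - y a))) = trace (gibbs B ** ?K) - c"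
    and a2: "(\<Sum>a\<in>UNIV. \<Sum>b\<in>UNIV. w a b * (exp (y a) * (x b - y a)\<^sup>2)) =
      trace (gibbs A ** (?K ** ?K)) - 2 * c * trace (gibbs A ** ?K) + c\<^sup>2"
    and b2: "(\<Sum>a\<in>UNIV. \<Sum>b\<in>UNIV. w a b * (exp (x b) * (x b - y a)\<^sup>2)) =
      trace (gibbs B ** (?K ** ?K)) - 2 * c * trace (gibbs B ** ?K) + c\<^sup>2"
    by (rule gibbs_coupling[OF A B, folded c_def]) (rule that, assumption+)
  have "d = (\<Sum>a\<in>UNIV. \<Sum>b\<in>UNIV. w a b * ((exp (x b) - exp (y a)) * (x b - y a)))"
    using a1 b1 by (simp add: d_def left_diff_distrib right_diff_distrib sum_subtractf)
  also have "\<dots> \<le> (\<Sum>a\<in>UNIV. \<Sum>b\<in>UNIV. w a b * ((exp (x b) + exp (y a)) / 2 * (x b - y a)\<^sup>2))"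
    by (intro sum_mono mult_left_mono exp_slope_le_mean w)
  also have "\<dots> = (\<Sum>a\<in>UNIV. \<Sum>b\<in>UNIV. 1/2 * (w a b * (exp (y a) * (x b - y a)\<^sup>2)) + 1/2 * (w a b * (exp (x b) * (x b - y a)\<^sup>2)))"
    by (intro sum.cong refl) (simp add: field_simps)
  also have "\<dots> = 1/2 * (trace (gibbs A ** (?K ** ?K)) - 2 * c * trace (gibbs A ** ?K) + c\<^sup>2)
      + 1/2 * (trace (gibbs B ** (?K ** ?K)) - 2 * c * trace (gibbs B ** ?K) + c\<^sup>2)"
    unfolding a2[symmetric] b2[symmetric] by (simp only: sum.distrib sum_distrib_left)
  finally have second_moment: "d \<le> \<dots>" .
  have K: "sym_matrix ?K" by (rule sym_matrix_diff[OF B A])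
  note varA = variance_spectrahedron_le[OF gibbs_in_spectrahedron[OF A] K]
  note varB = variance_spectrahedron_le[OF gibbs_in_spectrahedron[OF B] K]
  have "(c - trace (gibbs A ** ?K))\<^sup>2 + (trace (gibbs B ** ?K) - c)\<^sup>2 \<le> d\<^sup>2"
  proof -
    have "0 \<le> (c - trace (gibbs A ** ?K)) * (trace (gibbs B ** ?K) - c)" using c1 c2 by simp
    then show ?thesis unfolding d_def by (simp add: power2_eq_square algebra_simps)
  qed
  then show "d \<le> (norm (B - A))\<^sup>2 / 2 + d\<^sup>2 / 2"
    using second_moment varA varB by (simp add: power2_diff algebra_simps)
qed

text \<open>Cut the interval into \<open>n\<close> equal pieces: the total increment is at most a constant divided by
  \<open>n\<close>. This replaces differentiation along segments.\<close>

lemma nonincreasing_if_quadratic_increments: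
  fixes g :: "real \<Rightarrow> real"
  assumes st: "s \<le> t"
    and inc: "\<And>u v. s \<le> u \<Longrightarrow> u \<le> v \<Longrightarrow> v \<le> t \<Longrightarrow> g v - g u \<le> C * (v - u)\<^sup>2"
  shows "g t \<le> g s"
proof -
  have bound: "g t - g s \<le> C * (t - s)\<^sup>2 * inverse (real (Suc n))" for n
  proof -
    define e where "e = (t - s) / real (Suc n)"
    have e0: "e \<ge> 0" using st by (simp add: e_def)
    have se: "real (Suc n) * e = t - s" by (simp add: e_def)
    have "g t - g s = g (s + real (Suc n) * e) - g (s + real 0 * e)" unfolding se by simp
    also have "\<dots> = (\<Sum>i<Suc n. g (s + real (Suc i) * e) - g (s + real i * e))"
      by (rule sum_lessThan_telescope[symmetric])
    also have "\<dots> \<le> (\<Sum>i<Suc n. C * e\<^sup>2)"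
    proof (rule sum_mono)
      fix i assume "i \<in> {..<Suc n}"
      then have "real (Suc i) * e \<le> real (Suc n) * e" using e0 by (intro mult_right_mono) auto
      then have "g (s + real (Suc i) * e) - g (s + real i * e) \<le> C * ((s + real (Suc i) * e) - (s + real i * e))\<^sup>2"
        unfolding se using e0 by (intro inc) (auto simp: algebra_simps)
      then show "g (s + real (Suc i) * e) - g (s + real i * e) \<le> C * e\<^sup>2" by (simp add: algebra_simps)
    qed
    also have "\<dots> = C * (t - s)\<^sup>2 * inverse (real (Suc n))"
      by (simp add: e_def power2_eq_square field_simps del: of_nat_Suc)
    finally show ?thesis .
  qed
  have "(\<lambda>n. C * (t - s)\<^sup>2 * inverse (real (Suc n))) \<longlonglongrightarrow> C * (t - s)\<^sup>2 * 0"
    by (intro tendsto_intros LIMSEQ_inverse_real_of_nat)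
  then have "g t - g s \<le> C * (t - s)\<^sup>2 * 0" by (rule LIMSEQ_le_const) (use bound in auto)
  then show ?thesis by simp
qed

text \<open>Along the segment, \<open>h s\<close> is the slope of the log-partition function. A crude bound makes \<open>h\<close>
  Lipschitz with a constant \<open>C\<close>; inserted into \<open>gibbs_increment_le\<close> this makes the quadratic error
  there of higher order, and subdivision sharpens \<open>C\<close> to \<open>N = (norm K)\<^sup>2 / 2\<close>. A second
  subdivision integrates the bound on the slope.\<close>

lemma log_partition_smooth:
  fixes A K :: "real^'n^'n"
  assumes A: "sym_matrix A" and K: "sym_matrix K"
  shows "log_partition (A + K) \<le> log_partition A + trace (gibbs A ** K) + (norm K)\<^sup>2 / 4"
proof -
  define L where "L s = A + s *\<^sub>R K" for s
  define h where "h s = trace (gibbs (L s) ** K)" for s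
  define N where "N = (norm K)\<^sup>2 / 2"
  have sym: "sym_matrix (L s)" for s
    unfolding L_def by (intro sym_matrix_add sym_matrix_scaleR A K)
  have diff: "L t - L s = (t - s) *\<^sub>R K" for s t by (simp add: L_def algebra_simps)
  \<comment> \<open>\<open>gibbs_increment_le\<close> between two points of the segment, divided by \<open>t - s\<close>.\<close>
  have dh: "0 \<le> h t - h s \<and> h t - h s \<le> (t - s) * (N + (h t - h s)\<^sup>2 / 2)" if "s < t" for s t
  proof -
    have "0 \<le> (t - s) * (h t - h s)"
      using gibbs_increment_le(1)[OF sym[of s] sym[of t]]
      unfolding diff trace_mult_scaleR h_def by (simp add: right_diff_distrib)
    moreover have "(t - s) * (h t - h s) \<le> (t - s)\<^sup>2 * (norm K)\<^sup>2 / 2 + ((t - s) * (h t - h s))\<^sup>2 / 2"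
      using gibbs_increment_le(2)[OF sym[of s] sym[of t]]
      unfolding diff trace_mult_scaleR h_def right_diff_distrib[symmetric]
      by (simp add: power_mult_distrib)
    then have "(t - s) * (h t - h s) \<le> (t - s) * ((t - s) * (N + (h t - h s)\<^sup>2 / 2))"
      by (simp only: N_def power2_eq_square distrib_left times_divide_eq_right mult.assoc mult.left_commute)
    ultimately show ?thesis using that by (simp add: zero_le_mult_iff)
  qed
  have hb: "\<bar>h s\<bar> \<le> norm K" for s
    unfolding h_def by (rule abs_trace_spectrahedron_le[OF gibbs_in_spectrahedron[OF sym]])
  define C where "C = N + (2 * norm K)\<^sup>2 / 2"
  have lip: "0 \<le> h t - h s \<and> h t - h s \<le> (t - s) * C" if "s < t" for s t
  proof -
    have "h t - h s \<le> 2 * norm K" using hb[of s] hb[of t] by linarith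
    then have "(h t - h s)\<^sup>2 \<le> (2 * norm K)\<^sup>2" using dh[OF that] by (intro power_mono) auto
    then have "(t - s) * (N + (h t - h s)\<^sup>2 / 2) \<le> (t - s) * C"
      unfolding C_def using that by (intro mult_left_mono) auto
    then show ?thesis using dh[OF that] by linarith
  qed
  have slope: "h t - h 0 \<le> N * t" if t: "0 \<le> t" "t \<le> 1" for t
  proof -
    have "h t - N * t \<le> h 0 - N * 0"
    proof (rule nonincreasing_if_quadratic_increments[where g = "\<lambda>s. h s - N * s" and C = "C\<^sup>2 / 2"])
      fix u v assume uv: "0 \<le> u" "u \<le> v" "v \<le> t"
      show "h v - N * v - (h u - N * u) \<le> C\<^sup>2 / 2 * (v - u)\<^sup>2"
      proof (cases "u = v")
        case False
        with uv have lt: "u < v" by simp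
        have "(h v - h u)\<^sup>2 \<le> ((v - u) * C)\<^sup>2" using lip[OF lt] by (intro power_mono) auto
        then have "(v - u) * ((h v - h u)\<^sup>2 / 2) \<le> 1 * (((v - u) * C)\<^sup>2 / 2)"
          using uv t by (intro mult_mono) auto
        also have "\<dots> = C\<^sup>2 / 2 * (v - u)\<^sup>2" by (simp add: power_mult_distrib)
        finally have "(v - u) * ((h v - h u)\<^sup>2 / 2) \<le> C\<^sup>2 / 2 * (v - u)\<^sup>2" .
        moreover have "h v - h u \<le> N * (v - u) + (v - u) * ((h v - h u)\<^sup>2 / 2)"
          using dh[OF lt] unfolding distrib_left mult.commute[of N] by simp
        ultimately show ?thesis unfolding right_diff_distrib[of N] by linarith
      qed simp
    qed (use t in simp)
    then show ?thesis by simp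
  qed
  have "log_partition (L 1) - 1 * h 0 - N * 1\<^sup>2 / 2 \<le> log_partition (L 0) - 0 * h 0 - N * 0\<^sup>2 / 2"
  proof (rule nonincreasing_if_quadratic_increments[where C = "N / 2"
        and g = "\<lambda>s. log_partition (L s) - s * h 0 - N * s\<^sup>2 / 2"])
    fix u v :: real assume uv: "0 \<le> u" "u \<le> v" "v \<le> 1"
    have "log_partition (L v) - log_partition (L u) \<le> (v - u) * h v"
      using log_partition_le[OF sym[of u] sym[of v]] by (simp add: diff trace_mult_scaleR h_def)
    also have "\<dots> \<le> (v - u) * (h 0 + N * v)"
      using slope[of v] uv by (intro mult_left_mono) auto
    finally show "log_partition (L v) - v * h 0 - N * v\<^sup>2 / 2 - (log_partition (L u) - u * h 0 - N * u\<^sup>2 / 2)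
        \<le> N / 2 * (v - u)\<^sup>2"
      by (simp add: power2_eq_square algebra_simps)
  qed simp
  then show ?thesis by (simp add: L_def h_def N_def)
qed

section \<open>The objective function\<close>

lemma sym_matrix_pencil:
  assumes "\<And>i. sym_matrix (A i)"
  shows "sym_matrix (pencil A x)"
proof -
  have "A i $ k $ j = A i $ j $ k" for i j k
    using assms[of i] unfolding sym_matrix_def by (metis transpose_def vec_lambda_beta)
  then show ?thesis
    by (simp add: pencil_def sym_matrix_def transpose_def vec_eq_iff sum_component)
qed

lemma pencil_add: "pencil A (x + h) = pencil A x + pencil A h"
  by (simp add: pencil_def scaleR_left_distrib sum.distrib)

lemma trace_mult_pencil:
  fixes X :: "real^'n^'n"
  shows "trace (X ** pencil A h) = moment_map A X \<bullet> h"
proof -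
  have "pencil A h ** X = (\<Sum>i\<in>UNIV. h $ i *\<^sub>R (A i ** X))"
    unfolding pencil_def
    by (simp add: vec_eq_iff matrix_matrix_mult_def sum_distrib_left sum_distrib_right mult_ac)
      (intro allI sum.swap)
  then have "trace (pencil A h ** X) = (\<Sum>i\<in>UNIV. h $ i * trace (A i ** X))"
    by (simp add: trace_def sum_distrib_left) (rule sum.swap)
  then show ?thesis
    by (simp add: trace_mul_sym[of X] moment_map_def inner_vec_def mult.commute)
qed

lemma norm_pencil:
  fixes A :: "'m::finite \<Rightarrow> real^'n^'n"
  assumes sym: "\<And>i. sym_matrix (A i)"
    and orth: "\<And>i j. trace (A i ** A j) = (if i = j then 1 else 0)"
  shows "norm (pencil A h) = norm h"
proof -
  have inner: "A i \<bullet> A j = (if i = j then 1 else 0)" for i j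
    by (simp add: inner_sym_matrix_eq_trace[OF sym] orth)
  have "pencil A h \<bullet> pencil A h = (\<Sum>i\<in>UNIV. h $ i * h $ i)"
    unfolding pencil_def
    by (simp add: inner_sum_left inner_sum_right inner if_distrib cong: if_cong)
  then show ?thesis by (simp add: norm_eq_sqrt_inner inner_vec_def[of h])
qed

definition moment_residual :: "('m::finite \<Rightarrow> real^'n^'n) \<Rightarrow> real^'m \<Rightarrow> real^'m \<Rightarrow> real^'m" where
  "moment_residual A b x = moment_map A (gibbs (pencil A x)) - b"

lemma objective_eq: "objective A b x = log_partition (pencil A x) - b \<bullet> x"
  by (simp add: objective_def log_partition_def)

lemma objective_ge_linearization:
  fixes A :: "'m::finite \<Rightarrow> real^'n^'n"
  assumes sym: "\<And>i. sym_matrix (A i)"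
  shows "objective A b x + h \<bullet> moment_residual A b x \<le> objective A b (x + h)"
  using log_partition_ge[of "pencil A x" "pencil A (x + h)", OF sym_matrix_pencil[OF sym] sym_matrix_pencil[OF sym]]
  by (simp add: objective_eq moment_residual_def pencil_add trace_mult_pencil inner_diff_right
      inner_add_right inner_commute)

lemma objective_le_quadratic_model:
  fixes A :: "'m::finite \<Rightarrow> real^'n^'n"
  assumes sym: "\<And>i. sym_matrix (A i)"
    and orth: "\<And>i j. trace (A i ** A j) = (if i = j then 1 else 0)"
  shows "objective A b (x + h) \<le> objective A b x + h \<bullet> moment_residual A b x + (norm h)\<^sup>2 / 4"
  using log_partition_smooth[of "pencil A x" "pencil A h", OF sym_matrix_pencil[OF sym] sym_matrix_pencil[OF sym]]
  by (simp add: objective_eq moment_residual_def pencil_add trace_mult_pencil inner_diff_right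
      inner_add_right inner_commute norm_pencil[OF sym orth])

text \<open>The linearization error lies between 0 and a quarter of the squared distance, so the residual
  is the Frechet gradient.\<close>

lemma gradient_objective:
  fixes A :: "'m::finite \<Rightarrow> real^'n^'n"
  assumes sym: "\<And>i. sym_matrix (A i)"
    and orth: "\<And>i j. trace (A i ** A j) = (if i = j then 1 else 0)"
  shows "gradient (objective A b) x = moment_residual A b x"
proof (rule gradient_eq)
  show "GDERIV (objective A b) x :> moment_residual A b x"
    unfolding gderiv_def
  proof (rule has_derivativeI_sandwich[where e = 1 and H = "\<lambda>z. norm (z - x) / 4"])
    show "bounded_linear (\<lambda>h. h \<bullet> moment_residual A b x)" by (rule bounded_linear_inner_left)
    fix z assume z: "z \<noteq> x"
    have "0 \<le> objective A b z - objective A b x - (z - x) \<bullet> moment_residual A b x"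
      using objective_ge_linearization[of A b x "z - x", OF sym] by simp
    moreover have "objective A b z - objective A b x - (z - x) \<bullet> moment_residual A b x
        \<le> (norm (z - x))\<^sup>2 / 4"
      using objective_le_quadratic_model[of A b x "z - x", OF sym orth] by simp
    ultimately show "norm (objective A b z - objective A b x - (z - x) \<bullet> moment_residual A b x)
        / norm (z - x) \<le> norm (z - x) / 4"
      using z by (simp add: power2_eq_square divide_simps)
  next
    show "((\<lambda>z. norm (z - x) / 4) \<longlongrightarrow> 0) (at x)"
      by (auto intro!: tendsto_eq_intros)
  qed simp
qed

lemma objective_zero:
  fixes A :: "'m::finite \<Rightarrow> real^'n^'n"
  shows "objective A b 0 = ln (real CARD('n))"
proof -
  obtain f l where f: "eigenframe (0 :: real^'n^'n) f l"
    using spectral_theorem[of "0 :: real^'n^'n"] by (auto simp: sym_matrix_def transpose_def vec_eq_iff)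
  have "l a = 0" for a
    using f orthonormal_frame_nonzero[of f a] by (auto simp: eigenframe_def)
  then show ?thesis
    using trace_mat_exp_eigenframe[OF f] by (simp add: objective_def pencil_def)
qed

lemma eigenvalues_eigenframe:
  assumes X: "sym_matrix X" and f: "eigenframe X f l"
  shows "eigenvalues X = range l"
proof
  show "range l \<subseteq> eigenvalues X"
  proof safe
    fix a
    have "f a \<noteq> 0" using f by (simp add: eigenframe_def orthonormal_frame_nonzero)
    then show "l a \<in> eigenvalues X" using f by (auto simp: eigenvalues_def eigenframe_def)
  qed
  show "eigenvalues X \<subseteq> range l"
  proof
    fix c assume "c \<in> eigenvalues X"
    then obtain u where u: "u \<noteq> 0" "X *v u = c *\<^sub>R u" by (auto simp: eigenvalues_def)
    have "u \<bullet> u = (\<Sum>a\<in>UNIV. (f a \<bullet> u) * (f a \<bullet> u))"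
      using parseval f by (auto simp: eigenframe_def)
    then obtain a where a: "f a \<bullet> u \<noteq> 0" using u(1) by fastforce
    have "l a * (f a \<bullet> u) = c * (f a \<bullet> u)"
      using sym_matrix_inner[OF X, of "f a" u] u(2) f by (auto simp: eigenframe_def)
    then show "c \<in> range l" using a by auto
  qed
qed

lemma lambda_max_le_log_partition:
  assumes X: "sym_matrix X"
  shows "lambda_max X \<le> log_partition X"
proof -
  obtain f l where f: "eigenframe X f l" using spectral_theorem[OF X] .
  show ?thesis
    unfolding lambda_max_def eigenvalues_eigenframe[OF X f]
    using eigenvalue_le_log_partition[OF f] by (subst Max_le_iff) auto
qed

text \<open>In an eigenframe of \<open>X\<close> the trace is an average of eigenvalues of \<open>X\<close>, each of which is at
  most the log-partition value.\<close>

lemma trace_mult_spectrahedron_le_log_partition: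
  assumes X: "sym_matrix X" and Z: "Z \<in> spectrahedron"
  shows "trace (Z ** X) \<le> log_partition X"
proof -
  obtain f l where f: "eigenframe X f l" using spectral_theorem[OF X] .
  have "trace (Z ** X) = (\<Sum>a\<in>UNIV. l a * (f a \<bullet> (Z *v f a)))"
    unfolding trace_mul_sym[of Z] by (rule trace_eigenframe_mult[OF f])
  also have "\<dots> \<le> (\<Sum>a\<in>UNIV. log_partition X * (f a \<bullet> (Z *v f a)))"
    by (intro sum_mono mult_right_mono eigenvalue_le_log_partition[OF f] spectrahedronD(2)[OF Z])
  also have "\<dots> = log_partition X"
    using trace_frame[of f Z] f spectrahedronD(3)[OF Z]
    by (simp add: eigenframe_def flip: sum_distrib_left)
  finally show ?thesis .
qed

theorem theorem7:
  fixes A :: "'m::finite \<Rightarrow> real^'n^'n"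
    and b :: "real^'m"
    and y :: "nat \<Rightarrow> real^'m"
    and \<delta> :: real
  assumes "CARD('n) \<ge> 2"
    and "\<And>i. sym_matrix (A i)"
    and "\<And>i. trace (A i) = 0"
    and "\<And>i j. trace (A i ** A j) = (if i = j then 1 else 0)"
    and "b \<notin> moment_body A"
    and "\<delta> = infdist b (frontier (moment_body A))"
    and "\<And>k. y (Suc k) = y k - 2 *\<^sub>R gradient (objective A b) (y k)"
  shows "(\<forall>k. objective A b (y k) \<le> objective A b (y 0) - real k * \<delta>\<^sup>2) \<and>
    (\<forall>k. real k > objective A b (y 0) / \<delta>\<^sup>2 \<longrightarrow> objective A b (y k) < 0) \<and>
    (y 0 = 0 \<longrightarrow> (\<forall>k. real k > ln (real CARD('n)) / \<delta>\<^sup>2 \<longrightarrow> objective A b (y k) < 0)) \<and>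
    (\<forall>k. objective A b (y k) < 0 \<longrightarrow>
      (\<forall>z\<in>moment_body A. y k \<bullet> z < b \<bullet> y k) \<and> lambda_max (pencil A (y k)) < b \<bullet> y k) \<and>
    filterlim (\<lambda>k. objective A b (y k)) at_bot sequentially \<and>
    filterlim (\<lambda>k. norm (y k)) at_top sequentially"
proof -
  note sym = assms(2) and orth = assms(4)
  let ?f = "objective A b" and ?g = "moment_residual A b"
  have in_body: "moment_map A (gibbs (pencil A x)) \<in> moment_body A" for x
    unfolding moment_body_def by (intro imageI gibbs_in_spectrahedron sym_matrix_pencil sym)
  have \<delta>: "0 < \<delta>"
    unfolding assms(6) using in_body assms(5) by (intro infdist_frontier_pos compact_moment_body) auto
  have \<delta>_le: "\<delta> \<le> norm (?g x)" for x
    using infdist_frontier[OF assms(5) in_body[of x]]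
    by (simp add: assms(6) moment_residual_def dist_norm norm_minus_commute)
  have step: "?f (y (Suc k)) \<le> ?f (y k) - \<delta>\<^sup>2" for k
  proof -
    let ?r = "?g (y k)"
    have "?f (y (Suc k)) \<le> ?f (y k) + (- 2 *\<^sub>R ?r) \<bullet> ?r + (norm (- 2 *\<^sub>R ?r))\<^sup>2 / 4"
      using objective_le_quadratic_model[of A b "y k" "- 2 *\<^sub>R ?r", OF sym orth]
      by (simp add: assms(7) gradient_objective[OF sym orth])
    also have "\<dots> = ?f (y k) - (norm ?r)\<^sup>2"
      by (simp add: power_mult_distrib dot_square_norm)
    also have "\<dots> \<le> ?f (y k) - \<delta>\<^sup>2"
      using power_mono[OF \<delta>_le[of "y k"], of 2] \<delta> by simp
    finally show ?thesis .
  qed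
  have decrease: "?f (y k) \<le> ?f (y 0) - real k * \<delta>\<^sup>2" for k
  proof (induction k)
    case (Suc k)
    then show ?case using step[of k] by (simp add: algebra_simps)
  qed simp
  have negative: "?f (y k) < 0" if "real k > ?f (y 0) / \<delta>\<^sup>2" for k
  proof -
    have "?f (y 0) < real k * \<delta>\<^sup>2" using that \<delta> by (simp add: divide_simps)
    then show ?thesis using decrease[of k] by simp
  qed
  have separates: "y k \<bullet> z < b \<bullet> y k" if neg: "?f (y k) < 0" and z: "z \<in> moment_body A" for k z
  proof -
    obtain Z where Z: "Z \<in> spectrahedron" "z = moment_map A Z" using z by (auto simp: moment_body_def)
    show ?thesis
      using trace_mult_spectrahedron_le_log_partition[of "pencil A (y k)", OF sym_matrix_pencil[OF sym] Z(1)] neg Z(2)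
      by (simp add: objective_eq trace_mult_pencil inner_commute)
  qed
  have certificate: "lambda_max (pencil A (y k)) < b \<bullet> y k" if "?f (y k) < 0" for k
    using lambda_max_le_log_partition[of "pencil A (y k)", OF sym_matrix_pencil[OF sym]] that
    by (simp add: objective_eq)
  have affine: "filterlim (\<lambda>k. (real k * p - q) / r) at_top sequentially" if "p > 0" "r > 0" for p q r :: real
    using that by real_asymp
  have lim_bound: "filterlim (\<lambda>k. real k * \<delta>\<^sup>2 - ?f (y 0)) at_top sequentially"
    using affine[of "\<delta>\<^sup>2" 1 "?f (y 0)"] \<delta> by simp
  have "filterlim (\<lambda>k. - ?f (y k)) at_top sequentially"
    by (rule filterlim_at_top_mono[OF lim_bound]) (use decrease in \<open>auto simp: algebra_simps\<close>)
  then have unbounded: "filterlim (\<lambda>k. ?f (y k)) at_bot sequentially"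
    by (simp add: filterlim_uminus_at_bot)
  \<comment> \<open>The objective lies above its linearization at 0, whose slope has norm \<open>c\<close>; hence it can
    fall without bound only if the iterates leave every ball.\<close>
  define c where "c = norm (?g 0)"
  have c: "c > 0" using \<delta>_le[of 0] \<delta> unfolding c_def by linarith
  have norm_ge: "(real k * \<delta>\<^sup>2 - ?f (y 0) + ?f 0) / c \<le> norm (y k)" for k
  proof -
    have "\<bar>y k \<bullet> ?g 0\<bar> \<le> norm (y k) * c" unfolding c_def by (rule Cauchy_Schwarz_ineq2)
    moreover have "?f 0 + y k \<bullet> ?g 0 \<le> ?f (y k)"
      using objective_ge_linearization[of A b 0 "y k", OF sym] by simp
    ultimately have "real k * \<delta>\<^sup>2 - ?f (y 0) + ?f 0 \<le> norm (y k) * c"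
      using decrease[of k] by linarith
    then show ?thesis using c by (simp add: divide_simps)
  qed
  have "filterlim (\<lambda>k. (real k * \<delta>\<^sup>2 - ?f (y 0) + ?f 0) / c) at_top sequentially"
    using affine[of "\<delta>\<^sup>2" c "?f (y 0) - ?f 0"] \<delta> c by (simp add: algebra_simps)
  then have diverges: "filterlim (\<lambda>k. norm (y k)) at_top sequentially"
    by (rule filterlim_at_top_mono) (use norm_ge in auto)
  show ?thesis
    using decrease negative separates certificate unbounded diverges
    by (auto simp: objective_zero)
qed

end
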